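(* Let $G=(V,E)$ be an undirected graph on $n$ vertices with weight matrix $W$ and weighted Laplacian $L$, let $m_1$ be an integer with $1\le m_1\le n/2$, and let $\mathbf m=[m_1~\;n-m_1]^\top$. Then the quadratic matrix program (for the graph bisection problem) $$\min\;\tfrac12\langle L,PP^\top\rangle\quad\text{s.t.}\quad P\mathbf 1_2=\mathbf 1_n,\quad P^\top\mathbf 1_n=\mathbf m,\quad P\in\{0,1\}^{n\times 2}$$ is equivalent to the binary semidefinite program $$\min\;\tfrac12\langle L,X\rangle\quad\text{s.t.}\quad \operatorname{diag}(X)=\mathbf 1_n,\quad \langle\mathbf J_n,X\rangle=m_1^2+(n-m_1)^2,\quad 2X-\mathbf J_n\succeq\mathbf 0,\quad X\in\mathcal S^n,\quad X\in\{0,1\}^{n\times n}.$$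
   Context: $W=(w_{ij})\in\mathcal S^n$ is a real symmetric weight matrix with $w_{ij}=0$ if $\{i,j\}\notin E$, and $L=\operatorname{Diag}(W\mathbf 1_n)-W$, where $\operatorname{Diag}(v)$ is the diagonal matrix with diagonal $v$. $\mathcal S^n$ is the set of real symmetric $n\times n$ matrices; $\mathbf 1_n$ is the all-ones vector; $\mathbf J_n$ is the all-ones $n\times n$ matrix; $\langle X,Y\rangle=\operatorname{tr}(X^\top Y)$; $\succeq\mathbf 0$ means positive semidefinite; $\operatorname{diag}(X)$ is the vector of diagonal entries. Two optimization problems are called equivalent if every feasible solution of either one yields a feasible solution of the other with the same objective value. *)

theory Defs
  imports "HOL-Analysis.Analysis"
begin

text \<open>A minimization problem is the pair of its feasible set and its objective function.\<close>

type_synonym 'a optimization_problem = "'a set \<times> ('a \<Rightarrow> real)"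

definition equivalent_problems :: "'a optimization_problem \<Rightarrow> 'b optimization_problem \<Rightarrow> bool" where
  "equivalent_problems p q \<longleftrightarrow>
     (\<forall>x\<in>fst p. \<exists>y\<in>fst q. snd q y = snd p x) \<and>
     (\<forall>y\<in>fst q. \<exists>x\<in>fst p. snd p x = snd q y)"

definition symmetric_mat :: "real^'n^'n \<Rightarrow> bool" where
  "symmetric_mat A \<longleftrightarrow> transpose A = A"

definition psd :: "real^'n^'n \<Rightarrow> bool" where
  "psd A \<longleftrightarrow> symmetric_mat A \<and> (\<forall>x. 0 \<le> x \<bullet> (A *v x))"

definition mat_inner :: "real^'n^'m \<Rightarrow> real^'n^'m \<Rightarrow> real" where
  "mat_inner X Y = trace (transpose X ** Y)"

definition binary_mat :: "real^'n^'m \<Rightarrow> bool" where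
  "binary_mat A \<longleftrightarrow> (\<forall>i j. A $ i $ j \<in> {0, 1})"

definition ones_vec :: "real^'n" where
  "ones_vec = (\<chi> i. 1)"

definition ones_mat :: "real^'n^'n" where
  "ones_mat = (\<chi> i j. 1)"

definition diag_vec :: "real^'n^'n \<Rightarrow> real^'n" where
  "diag_vec A = (\<chi> i. A $ i $ i)"

definition Diag_mat :: "real^'n \<Rightarrow> real^'n^'n" where
  "Diag_mat v = (\<chi> i j. if i = j then v $ i else 0)"

text \<open>The vertex set is the whole index type \<open>'n\<close>. An edge is an unordered pair of vertices;
  loops (edges \<open>{u}\<close>) are allowed, so this covers simple graphs.\<close>

definition undirected_edges :: "'n set set \<Rightarrow> bool" where
  "undirected_edges E \<longleftrightarrow> (\<forall>e\<in>E. \<exists>u v. e = {u, v})"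

definition weight_matrix :: "'n set set \<Rightarrow> real^'n^'n \<Rightarrow> bool" where
  "weight_matrix E W \<longleftrightarrow> symmetric_mat W \<and> (\<forall>i j. {i, j} \<notin> E \<longrightarrow> W $ i $ j = 0)"

definition weighted_laplacian :: "real^'n^'n \<Rightarrow> real^'n^'n" where
  "weighted_laplacian W = Diag_mat (W *v ones_vec) - W"

definition bisection_qmp :: "real^'n^'n \<Rightarrow> nat \<Rightarrow> (real^2^'n) optimization_problem" where
  "bisection_qmp L m1 =
     ({P. P *v ones_vec = ones_vec \<and>
          transpose P *v ones_vec = vector [real m1, real CARD('n) - real m1] \<and>
          binary_mat P},
      \<lambda>P. 1 / 2 * mat_inner L (P ** transpose P))"

definition bisection_bsdp :: "real^'n^'n \<Rightarrow> nat \<Rightarrow> (real^'n^'n) optimization_problem" where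
  "bisection_bsdp L m1 =
     ({X. diag_vec X = ones_vec \<and>
          mat_inner ones_mat X = (real m1)\<^sup>2 + (real CARD('n) - real m1)\<^sup>2 \<and>
          psd (2 *\<^sub>R X - ones_mat) \<and>
          symmetric_mat X \<and>
          binary_mat X},
      \<lambda>X. 1 / 2 * mat_inner L X)"

end

theory Submission
  imports Defs
begin

text \<open>The two problems correspond via \<open>X = P P\<^sup>T\<close>. If \<open>a\<close> is the first column of \<open>P\<close> and
  \<open>s = 2 a - 1\<close> its sign vector, then \<open>2 X - J = s s\<^sup>T\<close>, which is positive semidefinite.
  Conversely, a positive semidefinite sign matrix with unit diagonal has rank one (its
  \<open>3 \<times> 3\<close> minors rule out negative triangles), so \<open>2 X - J = s s\<^sup>T\<close>. Since the entry sum
  of \<open>X\<close> is \<open>k\<^sup>2 + (n - k)\<^sup>2\<close>, where \<open>k\<close> is the number of positive signs, \<open>k\<close> equals \<open>m\<^sub>1\<close> or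
  \<open>n - m\<^sub>1\<close>; in the latter case replace \<open>s\<close> by \<open>-s\<close>.\<close>

text \<open>Unit row sums make the second column the complement of the first, so the first column
  \<open>a\<close> alone encodes a bisection.\<close>

definition partition_mat :: "('n \<Rightarrow> real) \<Rightarrow> real^2^'n" where
  "partition_mat a = (\<chi> i j. if j = 1 then a i else 1 - a i)"

lemma partition_mat_gram_nth:
  "(partition_mat a ** transpose (partition_mat a)) $ i $ j = a i * a j + (1 - a i) * (1 - a j)"
  by (simp add: matrix_matrix_mult_def transpose_def sum_2 partition_mat_def)

text \<open>Once the rows sum to one, the second column sum is \<open>CARD('n)\<close> minus the
  first, so a single sum constraint on \<open>a\<close> is left.\<close>

lemma qmp_feasible_iff:
  fixes P :: "real^2^'n"
  shows "P \<in> fst (bisection_qmp L m) \<longleftrightarrow>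
    (\<exists>a. P = partition_mat a \<and> (\<forall>i. a i \<in> {0, 1}) \<and> (\<Sum>i\<in>UNIV. a i) = real m)"
proof
  assume "P \<in> fst (bisection_qmp L m)"
  then have row: "P *v ones_vec = ones_vec"
    and col: "transpose P *v ones_vec = vector [real m, real CARD('n) - real m]"
    and bin: "binary_mat P"
    by (auto simp: bisection_qmp_def)
  have "P $ i $ 1 + P $ i $ 2 = 1" for i
    using arg_cong[OF row, of "\<lambda>v. v $ i"]
    by (simp add: matrix_vector_mult_def sum_2 ones_vec_def)
  then have "P = partition_mat (\<lambda>i. P $ i $ 1)"
    by (auto simp: vec_eq_iff partition_mat_def forall_2 algebra_simps)
  moreover have "(\<Sum>i\<in>UNIV. P $ i $ 1) = real m"
    using arg_cong[OF col, of "\<lambda>v. v $ 1"]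
    by (simp add: matrix_vector_mult_def ones_vec_def transpose_def)
  ultimately show "\<exists>a. P = partition_mat a \<and> (\<forall>i. a i \<in> {0, 1}) \<and> (\<Sum>i\<in>UNIV. a i) = real m"
    using bin unfolding binary_mat_def by blast
next
  assume "\<exists>a. P = partition_mat a \<and> (\<forall>i. a i \<in> {0, 1}) \<and> (\<Sum>i\<in>UNIV. a i) = real m"
  then show "P \<in> fst (bisection_qmp L m)"
    by (auto simp: bisection_qmp_def partition_mat_def binary_mat_def vec_eq_iff forall_2 sum_2
        matrix_vector_mult_def ones_vec_def transpose_def sum_subtractf)
qed

lemma sum_partition_gram:
  fixes a :: "'n::finite \<Rightarrow> real"
  shows "(\<Sum>i\<in>UNIV. \<Sum>j\<in>UNIV. a i * a j + (1 - a i) * (1 - a j)) =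
    (\<Sum>i\<in>UNIV. a i)\<^sup>2 + (real CARD('n) - (\<Sum>i\<in>UNIV. a i))\<^sup>2"
proof -
  have "(\<Sum>i\<in>UNIV. \<Sum>j\<in>UNIV. a i * a j + (1 - a i) * (1 - a j)) =
    (\<Sum>i\<in>UNIV. a i) * (\<Sum>j\<in>UNIV. a j) + (\<Sum>i\<in>UNIV. 1 - a i) * (\<Sum>j\<in>UNIV. 1 - a j)"
    by (simp only: sum_product sum.distrib)
  then show ?thesis
    by (simp add: sum_subtractf power2_eq_square)
qed

lemma mat_inner_ones_mat:
  fixes X :: "real^'n^'n"
  shows "mat_inner ones_mat X = (\<Sum>i\<in>UNIV. \<Sum>j\<in>UNIV. X $ i $ j)"
  unfolding mat_inner_def trace_def matrix_matrix_mult_def transpose_def ones_mat_def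
  by (simp, rule sum.swap)

text \<open>The quadratic form is the square of the sum of all \<open>x $ i * s i\<close>.\<close>

lemma psd_rank_one:
  fixes Y :: "real^'n^'n"
  assumes "\<And>i j. Y $ i $ j = s i * s j"
  shows "psd Y"
  unfolding psd_def
proof (intro conjI allI)
  show "symmetric_mat Y"
    by (simp add: symmetric_mat_def transpose_def vec_eq_iff assms)
  show "0 \<le> x \<bullet> (Y *v x)" for x
  proof -
    have "x \<bullet> (Y *v x) = (\<Sum>i\<in>UNIV. x $ i * s i) * (\<Sum>j\<in>UNIV. x $ j * s j)"
      unfolding sum_product
      by (simp add: inner_vec_def matrix_vector_mult_def assms sum_distrib_left algebra_simps)
    then show ?thesis by simp
  qed
qed

lemma inner_axis_matrix_axis:
  fixes Y :: "real^'n^'n"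
  shows "axis i 1 \<bullet> (Y *v axis j 1) = Y $ i $ j"
  by (simp add: inner_axis' matrix_vector_mult_basis column_def)

lemma psd_sign_mat_rank_one:
  fixes Y :: "real^'n^'n"
  assumes psd: "psd Y" and diag: "\<And>i. Y $ i $ i = 1"
    and sign: "\<And>i j. Y $ i $ j = 1 \<or> Y $ i $ j = -1"
  shows "Y $ i $ j = Y $ k $ i * Y $ k $ j"
proof -
  have sym: "Y $ p $ q = Y $ q $ p" for p q
    using psd by (simp add: psd_def symmetric_mat_def transpose_def vec_eq_iff)
  define b c where "b = Y $ k $ i" and "c = Y $ k $ j"
  \<comment> \<open>This vector tests the triangle \<open>k\<close>, \<open>i\<close>,
    \<open>j\<close>: since \<open>b\<close> and \<open>c\<close> are signs, its quadratic form is
    \<open>2 * b * c * Y $ i $ j - 1\<close>. Nonnegativity excludes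
    \<open>b * c * Y $ i $ j = -1\<close>, which leaves \<open>Y $ i $ j = b * c\<close>. The
    expansion is bilinear, so the indices may coincide.\<close>
  define v where "v = axis k 1 - b *\<^sub>R axis i 1 - c *\<^sub>R axis j (1::real)"
  have "0 \<le> v \<bullet> (Y *v v)"
    using psd by (simp add: psd_def)
  also have "v \<bullet> (Y *v v) = 1 + b\<^sup>2 + c\<^sup>2 - 2 * b * Y $ k $ i - 2 * c * Y $ k $ j + 2 * b * c * Y $ i $ j"
    unfolding v_def matrix_vector_mult_diff_distrib matrix_vector_mult_scaleR inner_diff_left
      inner_diff_right inner_scaleR_left inner_scaleR_right inner_axis_matrix_axis
      diag sym[of i k] sym[of j k] sym[of j i]
    by algebra
  finally have "0 \<le> 1 + b\<^sup>2 + c\<^sup>2 - 2 * b * b - 2 * c * c + 2 * b * c * Y $ i $ j"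
    by (simp only: b_def c_def)
  then show ?thesis
    using sign[of k i, folded b_def] sign[of k j, folded c_def] sign[of i j]
    unfolding b_def[symmetric] c_def[symmetric] by (elim disjE) simp_all
qed

lemma gram_feasible:
  fixes a :: "'n::finite \<Rightarrow> real"
  assumes bin: "\<And>i. a i \<in> {0, 1}" and total: "(\<Sum>i\<in>UNIV. a i) = real m"
  shows "partition_mat a ** transpose (partition_mat a) \<in> fst (bisection_bsdp L m)"
proof -
  define X where "X = partition_mat a ** transpose (partition_mat a)"
  have X: "X $ i $ j = a i * a j + (1 - a i) * (1 - a j)" for i j
    by (simp add: X_def partition_mat_gram_nth)
  have bin': "a i = 0 \<or> a i = 1" for i
    using bin[of i] by simp
  have "X $ i $ i = 1" for i
    using bin'[of i] by (auto simp: X)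
  then have "diag_vec X = ones_vec"
    by (simp add: diag_vec_def ones_vec_def)
  moreover have "mat_inner ones_mat X = (real m)\<^sup>2 + (real CARD('n) - real m)\<^sup>2"
    by (simp add: mat_inner_ones_mat X sum_partition_gram total)
  moreover have "psd (2 *\<^sub>R X - ones_mat)"
    \<comment> \<open>For all reals, \<open>2 * (x * y + (1 - x) * (1 - y)) - 1 = (2 * x - 1) * (2 *
      y - 1)\<close>.\<close>
    by (rule psd_rank_one[where s = "\<lambda>i. 2 * a i - 1"]) (simp add: X ones_mat_def algebra_simps)
  moreover have "symmetric_mat X"
    by (simp add: symmetric_mat_def transpose_def vec_eq_iff X algebra_simps)
  moreover have "X $ i $ j \<in> {0, 1}" for i j
    using bin'[of i] bin'[of j] by (auto simp: X)
  then have "binary_mat X"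
    by (simp add: binary_mat_def)
  ultimately show ?thesis
    by (simp add: bisection_bsdp_def X_def)
qed

lemma bsdp_feasible_obtains_partition:
  fixes X :: "real^'n^'n"
  assumes "X \<in> fst (bisection_bsdp L m)"
  obtains a where "\<forall>i. a i \<in> {0, 1}" "(\<Sum>i\<in>UNIV. a i) = real m"
    "X = partition_mat a ** transpose (partition_mat a)"
proof -
  have diag: "diag_vec X = ones_vec"
    and total: "mat_inner ones_mat X = (real m)\<^sup>2 + (real CARD('n) - real m)\<^sup>2"
    and psd: "psd (2 *\<^sub>R X - ones_mat)" and "binary_mat X"
    using assms by (auto simp: bisection_bsdp_def)
  then have bin: "X $ i $ j = 0 \<or> X $ i $ j = 1" for i j
    by (simp add: binary_mat_def)
  have diag1: "X $ i $ i = 1" for i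
    using arg_cong[OF diag, of "\<lambda>v. v $ i"] by (simp add: diag_vec_def ones_vec_def)
  \<comment> \<open>Any vertex \<open>k\<close> serves as reference, and types are nonempty. Row
    \<open>k\<close> of \<open>X\<close> then marks the vertices on the same side as
    \<open>k\<close>.\<close>
  obtain k :: 'n where True by simp
  define a where "a i = X $ k $ i" for i
  have rank: "2 * X $ i $ j - 1 = (2 * a i - 1) * (2 * a j - 1)" for i j
  proof -
    have "(2 *\<^sub>R X - ones_mat) $ p $ q = 1 \<or> (2 *\<^sub>R X - ones_mat) $ p $ q = -1" for p q
      using bin[of p q] by (auto simp: ones_mat_def)
    from psd_sign_mat_rank_one[OF psd _ this, of i j k] show ?thesis
      by (simp add: ones_mat_def a_def diag1)
  qed
  have X: "X $ i $ j = a i * a j + (1 - a i) * (1 - a j)" for i j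
    using rank[of i j] by (simp add: algebra_simps)
  define t where "t = (\<Sum>i\<in>UNIV. a i)"
  have "t\<^sup>2 + (real CARD('n) - t)\<^sup>2 = (real m)\<^sup>2 + (real CARD('n) - real m)\<^sup>2"
    using total by (simp add: mat_inner_ones_mat X sum_partition_gram t_def)
  \<comment> \<open>The two sides of the previous equation differ by twice this product.\<close>
  then have "(t - real m) * (t + real m - real CARD('n)) = 0"
    by (simp add: power2_eq_square algebra_simps)
  then have "t = real m \<or> t + real m - real CARD('n) = 0"
    by (simp only: mult_eq_0_iff right_minus_eq)
  then consider "t = real m" | "real CARD('n) - t = real m"
    by linarith
  then show ?thesis
  proof cases
    case 1
    have "a i \<in> {0, 1}" for i
      using bin[of k i] by (auto simp: a_def)
    moreover have "(\<Sum>i\<in>UNIV. a i) = real m"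
      using 1 by (simp add: t_def)
    moreover have "X = partition_mat a ** transpose (partition_mat a)"
      by (simp add: vec_eq_iff partition_mat_gram_nth X)
    ultimately show ?thesis
      by (rule that[OF allI])
  next
    case 2
    \<comment> \<open>Here the side of \<open>k\<close> has \<open>CARD('n) - m\<close> vertices.
      Complementing \<open>a\<close> swaps the two columns, which leaves the Gram matrix
      unchanged.\<close>
    have "1 - a i \<in> {0, 1}" for i
      using bin[of k i] by (auto simp: a_def)
    moreover have "(\<Sum>i\<in>UNIV. 1 - a i) = real m"
      using 2 by (simp add: sum_subtractf t_def)
    moreover have "X = partition_mat (\<lambda>i. 1 - a i) ** transpose (partition_mat (\<lambda>i. 1 - a i))"
      by (simp add: vec_eq_iff partition_mat_gram_nth X)
    ultimately show ?thesis
      by (rule that[OF allI])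
  qed
qed

text \<open>The map from \<open>P\<close> to \<open>P ** transpose P\<close> preserves the objective
  value, so its surjectivity between the feasible sets gives both directions of the
  equivalence.\<close>

lemma bsdp_feasible_eq_gram_image:
  fixes L :: "real^'n^'n"
  shows "fst (bisection_bsdp L m) = (\<lambda>P. P ** transpose P) ` fst (bisection_qmp L m)"
proof (intro equalityI subsetI)
  fix X assume "X \<in> fst (bisection_bsdp L m)"
  then obtain a where "\<forall>i. a i \<in> {0, 1}" "(\<Sum>i\<in>UNIV. a i) = real m"
    and X: "X = partition_mat a ** transpose (partition_mat a)"
    by (rule bsdp_feasible_obtains_partition)
  then have "partition_mat a \<in> fst (bisection_qmp L m)"
    unfolding qmp_feasible_iff by blast
  then show "X \<in> (\<lambda>P. P ** transpose P) ` fst (bisection_qmp L m)"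
    unfolding X by (rule imageI)
next
  fix X assume "X \<in> (\<lambda>P. P ** transpose P) ` fst (bisection_qmp L m)"
  then obtain a where "X = partition_mat a ** transpose (partition_mat a)"
    and "\<forall>i. a i \<in> {0, 1}" "(\<Sum>i\<in>UNIV. a i) = real m"
    unfolding qmp_feasible_iff image_iff Bex_def by blast
  then show "X \<in> fst (bisection_bsdp L m)"
    using gram_feasible by blast
qed

theorem proposition8:
  fixes E :: "'n::finite set set" and W :: "real^'n^'n" and m1 :: nat
  assumes "undirected_edges E"
    and "weight_matrix E W"
    and "1 \<le> m1" and "real m1 \<le> real CARD('n) / 2"
  shows "equivalent_problems
           (bisection_qmp (weighted_laplacian W) m1)
           (bisection_bsdp (weighted_laplacian W) m1)"
proof -
  have "snd (bisection_bsdp L m1) (P ** transpose P) = snd (bisection_qmp L m1) P"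
    for L :: "real^'n^'n" and P
    by (simp add: bisection_qmp_def bisection_bsdp_def)
  then show ?thesis
    unfolding equivalent_problems_def bsdp_feasible_eq_gram_image by auto
qed

end
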